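(* Let $\Gamma$ be a countable discrete group and $p\in[1,2)$. Then for any finite subset $F\subset\Gamma$ there exist $f_i\in\mathcal M_p^{\le1}(\Gamma)$, $i\in\mathbb N$, with $\sum_{i=1}^\infty\|f_i\|_p^p\le1$ such that the positive definite function $$\varphi=\sum_{i=1}^\infty\Phi(f_i)$$ minimizes the expression $$d_F(\psi,1):=\sup\{|\psi(s)-1|:s\in F\}$$ over all positive definite functions $\psi$ of this form (i.e. all $\psi=\sum_{i=1}^\infty\Phi(g_i)$ with $g_i\in\mathcal M_p^{\le1}(\Gamma)$ and $\sum_{i=1}^\infty\|g_i\|_p^p\le1$), and in particular over all $\psi\in P_p(\Gamma)$.
   Context: $\mathcal M_p^{\le1}(\Gamma)=\{f:\Gamma\to[0,1]:\|f\|_p\le1\}$. For $f\in\ell^2(\Gamma)$, $\Phi(f):\Gamma\to\mathbb C$ is $\Phi(f)(s)=\sum_{t\in\Gamma}f(t)\overline{f(ts)}$. A function $\varphi:\Gamma\to\mathbb C$ is positive definite if $[\varphi(s^{-1}t)]_{s,t\in F'}$ is a positive (semidefinite) matrix for every finite $F'\subset\Gamma$. $P_p(\Gamma)=\Phi(\mathcal M_p^{\le1}(\Gamma))$. *)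

theory Defs
  imports "HOL-Algebra.Group" "HOL-Analysis.Infinite_Sum" "HOL-Library.Nonpos_Ints"
begin

text \<open>
  A function on the group is a HOL function on the type of group elements; only its
  values on the carrier are meaningful.
\<close>

definition lp_norm :: "('a, 'b) monoid_scheme \<Rightarrow> real \<Rightarrow> ('a \<Rightarrow> complex) \<Rightarrow> real" where
  "lp_norm G p f = (\<Sum>\<^sub>\<infinity>s\<in>carrier G. cmod (f s) powr p) powr (1 / p)"

text \<open>
  \<^const>\<open>infsum\<close> is 0 on non-summable families, so \<open>\<parallel>f\<parallel>\<^sub>p < \<infinity>\<close> is required explicitly.
\<close>

definition M_le1 :: "('a, 'b) monoid_scheme \<Rightarrow> real \<Rightarrow> ('a \<Rightarrow> complex) set" where
  "M_le1 G p = {f \<in> carrier G \<rightarrow> complex_of_real ` {0..1}.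
     (\<lambda>s. cmod (f s) powr p) summable_on carrier G \<and> lp_norm G p f \<le> 1}"

definition Phi :: "('a, 'b) monoid_scheme \<Rightarrow> ('a \<Rightarrow> complex) \<Rightarrow> 'a \<Rightarrow> complex" where
  "Phi G f s = (\<Sum>\<^sub>\<infinity>t\<in>carrier G. f t * cnj (f (t \<otimes>\<^bsub>G\<^esub> s)))"

definition P_set :: "('a, 'b) monoid_scheme \<Rightarrow> real \<Rightarrow> ('a \<Rightarrow> complex) set" where
  "P_set G p = Phi G ` M_le1 G p"

text \<open>
  Over the complex numbers, a quadratic form with values in the nonnegative reals
  comes from a Hermitian matrix, so no symmetry condition is needed.
\<close>

definition positive_matrix_on :: "'a set \<Rightarrow> ('a \<Rightarrow> 'a \<Rightarrow> complex) \<Rightarrow> bool" where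
  "positive_matrix_on I A \<longleftrightarrow>
     (\<forall>c :: 'a \<Rightarrow> complex. (\<Sum>s\<in>I. \<Sum>t\<in>I. cnj (c s) * A s t * c t) \<in> \<real>\<^sub>\<ge>\<^sub>0)"

definition positive_definite :: "('a, 'b) monoid_scheme \<Rightarrow> ('a \<Rightarrow> complex) \<Rightarrow> bool" where
  "positive_definite G \<phi> \<longleftrightarrow>
     (\<forall>I. finite I \<longrightarrow> I \<subseteq> carrier G \<longrightarrow>
        positive_matrix_on I (\<lambda>s t. \<phi> (inv\<^bsub>G\<^esub> s \<otimes>\<^bsub>G\<^esub> t)))"

text \<open>The sequence is indexed from 0, and the series of functions is taken pointwise.\<close>

definition is_Phi_series ::
  "('a, 'b) monoid_scheme \<Rightarrow> real \<Rightarrow> (nat \<Rightarrow> 'a \<Rightarrow> complex) \<Rightarrow> ('a \<Rightarrow> complex) \<Rightarrow> bool" where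
  "is_Phi_series G p f \<phi> \<longleftrightarrow>
     (\<forall>i. f i \<in> M_le1 G p) \<and>
     summable (\<lambda>i. lp_norm G p (f i) powr p) \<and>
     (\<Sum>i. lp_norm G p (f i) powr p) \<le> 1 \<and>
     (\<forall>s\<in>carrier G. (\<lambda>i. Phi G (f i) s) sums \<phi> s)"

text \<open>
  For \<open>F = {}\<close> this is the constant \<open>Sup {}\<close> of type \<^typ>\<open>real\<close>, independent of \<open>\<psi>\<close>
  and \<open>\<chi>\<close>, so its value does not affect comparisons.
\<close>

definition dist_on :: "'a set \<Rightarrow> ('a \<Rightarrow> complex) \<Rightarrow> ('a \<Rightarrow> complex) \<Rightarrow> real" where
  "dist_on F \<psi> \<chi> = (SUP s\<in>F. cmod (\<psi> s - \<chi> s))"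

end

theory Submission
  imports Defs "HOL-Complex_Analysis.Great_Picard"
begin

text \<open>
  A sequence \<open>f\<^sub>0, f\<^sub>1, \<dots>\<close> of functions on \<open>\<Gamma>\<close> is one nonnegative function \<open>h\<close> on countably many
  copies \<open>\<nat> \<times> \<Gamma>\<close> of the group. The constraint on the sequence says that \<open>h\<close> is in the unit ball of
  \<open>\<ell>\<^sup>p\<close>, and \<open>\<Sum>\<^sub>i \<Phi>(f\<^sub>i)(s)\<close> is the correlation \<open>\<Sum>\<^sub>y h(y) h(y\<cdot>s)\<close>, where \<open>y\<cdot>s\<close> is the right
  translate of \<open>y\<close> inside its copy. The theorem follows from a compactness statement: along a
  subsequence, the correlations of any sequence \<open>h\<^sub>n\<close> in the ball converge pointwise to the
  correlation of another element of the ball (\<open>correlation_compactness\<close>). Applied to a sequence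
  that minimizes the distance to 1 on \<open>F\<close>, this gives the minimizer.

  A pointwise limit of the \<open>h\<^sub>n\<close> would not do, because pieces of \<open>h\<^sub>n\<close> may drift off to infinity in
  different directions. What survives is the shape of every piece, so the limit is taken in
  coordinates that do not see the position: list the points \<open>x\<^sub>n(0), x\<^sub>n(1), \<dots>\<close> by decreasing value of
  \<open>h\<^sub>n\<close>, and pass to a subsequence along which the value \<open>h\<^sub>n(x\<^sub>n(k))\<close> converges for each \<open>k\<close>, and the
  truth value of \<open>x\<^sub>n(l) = x\<^sub>n(k)\<cdot>s\<close> is eventually constant for all \<open>k, l, s\<close>. The eventual relations
  say which points stay at a fixed relative position. They form an equivalence relation on the
  indices, each class of which is a piece that survives; giving every class its own copy of \<open>\<Gamma>\<close>
  realizes all relations at once by points \<open>x'(k)\<close> (\<open>realize_relative_positions\<close>). The limit is the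
  function with the limiting values at these points. One \<open>f\<close> may split into several pieces,
  which is why the minimum is sought among series rather than among single functions.

  Convergence of the correlations needs the contribution of all but the first \<open>K\<close> points to be small
  uniformly in \<open>n\<close>. The \<open>K\<close>-th largest value in the \<open>\<ell>\<^sup>p\<close> ball is at most \<open>K\<^bsup>-1/p\<^esup>\<close>, and a product
  with one factor at most \<open>\<epsilon>\<close> satisfies \<open>a b \<le> \<epsilon>\<^bsup>1-p/2\<^esup> (a\<^sup>p + b\<^sup>p) / 2\<close>; the exponent \<open>1 - p/2\<close> is
  positive exactly because \<open>p < 2\<close> (\<open>correlation_truncation\<close>, \<open>correlation_tendsto\<close>).
\<close>

section \<open>The unit ball of nonnegative functions in l^p\<close>

text \<open>
  Bounding the finite partial sums expresses summability and the norm bound together, and it passes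
  to limits without any Fatou argument.
\<close>

definition ell_ball :: "real \<Rightarrow> 'b set \<Rightarrow> ('b \<Rightarrow> real) set" where
  "ell_ball p A = {h. (\<forall>y\<in>A. 0 \<le> h y) \<and> (\<forall>T\<subseteq>A. finite T \<longrightarrow> (\<Sum>y\<in>T. h y powr p) \<le> 1)}"

lemma ell_ball_nonneg: "h \<in> ell_ball p A \<Longrightarrow> y \<in> A \<Longrightarrow> 0 \<le> h y"
  by (simp add: ell_ball_def)

lemma ell_ball_sum_le: "h \<in> ell_ball p A \<Longrightarrow> finite T \<Longrightarrow> T \<subseteq> A \<Longrightarrow> (\<Sum>y\<in>T. h y powr p) \<le> 1"
  by (simp add: ell_ball_def)

text \<open>
  Chebyshev's inequality. For the \<open>k\<close>-th largest value it gives the decay \<open>k\<^bsup>-1/p\<^esup>\<close>, with the same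
  constant for the whole ball.
\<close>

lemma ell_ball_le_root:
  assumes h: "h \<in> ell_ball p A" and p: "0 < p"
    and T: "finite T" "T \<subseteq> A" "T \<noteq> {}" and c: "0 \<le> c" "\<And>y. y \<in> T \<Longrightarrow> c \<le> h y"
  shows "c \<le> real (card T) powr (- (1 / p))"
proof -
  have card: "0 < card T" using T by (simp add: card_gt_0_iff)
  have "real (card T) * c powr p = (\<Sum>y\<in>T. c powr p)" by simp
  also have "\<dots> \<le> (\<Sum>y\<in>T. h y powr p)"
    using c p by (intro sum_mono powr_mono2) auto
  also have "\<dots> \<le> 1" using ell_ball_sum_le[OF h] T by blast
  finally have "c powr p \<le> inverse (real (card T))"
    using card by (simp add: field_simps)
  then have "(c powr p) powr (1 / p) \<le> inverse (real (card T)) powr (1 / p)"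
    using p by (intro powr_mono2) auto
  then show ?thesis
    using c p card by (simp add: powr_powr powr_minus inverse_powr)
qed

lemma ell_ball_le_1:
  assumes "h \<in> ell_ball p A" "0 < p" "y \<in> A"
  shows "h y \<le> 1"
  using ell_ball_le_root[of h p A "{y}" "h y"] assms ell_ball_nonneg[of h p A y] by simp

lemma ell_ball_finite_superlevel:
  assumes h: "h \<in> ell_ball p A" and p: "0 < p" and e: "0 < e"
  shows "finite {y \<in> A. e \<le> h y}"
proof (rule ccontr)
  assume inf: "infinite {y \<in> A. e \<le> h y}"
  obtain N :: nat where N: "1 / e powr p < real N" using reals_Archimedean2 by blast
  obtain T where T: "T \<subseteq> {y \<in> A. e \<le> h y}" "finite T" "card T = N"
    using infinite_arbitrarily_large[OF inf] by blast
  have "1 < real N * e powr p" using N e by (simp add: field_simps)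
  also have "\<dots> = (\<Sum>y\<in>T. e powr p)" using T by simp
  also have "\<dots> \<le> (\<Sum>y\<in>T. h y powr p)"
    using T e p by (intro sum_mono powr_mono2) auto
  also have "\<dots> \<le> 1" using ell_ball_sum_le[OF h] T by blast
  finally show False by simp
qed

lemma ell_ball_powr_summable:
  assumes "h \<in> ell_ball p A" "B \<subseteq> A"
  shows "(\<lambda>y. h y powr p) summable_on B"
  by (rule nonneg_bounded_partial_sums_imp_summable_on[where C = 1])
    (use assms ell_ball_sum_le[OF assms(1)] in \<open>auto simp: eventually_finite_subsets_at_top intro!: exI[of _ "{}"]\<close>)

text \<open>
  Only finitely many values exceed a given positive level, so a maximum exists outside every finite
  set and the points can be listed greedily. The list need not exhaust \<open>A\<close>: if infinitely many
  values are positive, zeros of \<open>h\<close> are never reached.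
\<close>

lemma decreasing_enumeration:
  fixes h :: "'b \<Rightarrow> real"
  assumes inf: "infinite A" and nonneg: "\<And>y. y \<in> A \<Longrightarrow> 0 \<le> h y"
    and fin: "\<And>e. 0 < e \<Longrightarrow> finite {y \<in> A. e \<le> h y}"
  obtains x :: "nat \<Rightarrow> 'b" where "inj x" "range x \<subseteq> A"
    "\<And>k y. y \<in> A - x ` {..<k} \<Longrightarrow> h y \<le> h (x k)"
proof -
  have pick: "\<exists>z\<in>A - S. \<forall>y\<in>A - S. h y \<le> h z" if "finite S" for S
  proof (cases "\<exists>y\<in>A - S. 0 < h y")
    case True
    then obtain y0 where y0: "y0 \<in> A - S" "0 < h y0" by blast
    let ?L = "{y \<in> A - S. h y0 \<le> h y}"
    have "finite ?L" by (rule finite_subset[OF _ fin[OF y0(2)]]) auto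
    moreover have "?L \<noteq> {}" using y0 by auto
    ultimately have "Max (h ` ?L) \<in> h ` ?L" by (intro Max_in) auto
    then obtain z where z: "z \<in> ?L" "h z = Max (h ` ?L)" by force
    then have "h y \<le> h z" if "y \<in> ?L" for y using \<open>finite ?L\<close> that by simp
    then show ?thesis using z by force
  next
    case False
    obtain z where "z \<in> A - S" using inf \<open>finite S\<close>
      by (metis Diff_eq_empty_iff equals0I finite_subset)
    then show ?thesis using False nonneg by (intro bexI[of _ z]) force+
  qed
  then obtain c where c: "\<And>S. finite S \<Longrightarrow> c S \<in> A - S"
    "\<And>S y. finite S \<Longrightarrow> y \<in> A - S \<Longrightarrow> h y \<le> h (c S)"
    by metis
  define S where "S = rec_nat {} (\<lambda>_ T. insert (c T) T)"
  define x where "x k = c (S k)" for k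
  have S_image: "S k = x ` {..<k}" for k
    by (induction k) (simp_all add: S_def x_def lessThan_Suc)
  have fresh: "x k \<in> A - x ` {..<k}" for k
  proof -
    have "x k \<in> A - S k" unfolding x_def by (rule c(1)) (simp add: S_image)
    then show ?thesis by (simp only: S_image)
  qed
  show thesis
  proof
    show "inj x"
    proof (rule linorder_injI)
      show "x j \<noteq> x k" if "j < k" for j k using fresh[of k] that by (metis DiffD2 imageI lessThan_iff)
    qed
    show "range x \<subseteq> A" using fresh by blast
    show "h y \<le> h (x k)" if "y \<in> A - x ` {..<k}" for k y
    proof -
      have "y \<in> A - S k" using that by (simp only: S_image)
      then show ?thesis unfolding x_def by (rule c(2)[rotated]) (simp add: S_image)
    qed
  qed
qed

section \<open>Correlations and their truncation\<close>

text \<open>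
  Split \<open>a b = (a b)\<^bsup>1-p/2\<^esup> (a b)\<^bsup>p/2\<^esup>\<close>; the first factor is controlled by \<open>a b \<le> \<epsilon>\<close>, the second by the
  inequality between geometric and arithmetic means. For \<open>p < 2\<close> the coefficient vanishes with \<open>\<epsilon>\<close>.
\<close>

lemma mult_le_powr_mean:
  fixes a b \<epsilon> p :: real
  assumes "0 \<le> a" "a \<le> 1" "0 \<le> b" "b \<le> 1" and "p \<le> 2" and small: "a \<le> \<epsilon> \<or> b \<le> \<epsilon>"
  shows "a * b \<le> \<epsilon> powr (1 - p / 2) * ((a powr p + b powr p) / 2)"
proof (cases "a = 0 \<or> b = 0")
  case True
  then show ?thesis by (auto simp: zero_le_mult_iff)
next
  case False
  then have pos: "0 < a" "0 < b" using assms by auto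
  have "a * b \<le> \<epsilon>"
    using small mult_left_le[of b a] mult_left_le_one_le[of b a] assms by linarith
  then have "(a * b) powr (1 - p / 2) \<le> \<epsilon> powr (1 - p / 2)"
    using assms by (intro powr_mono2) auto
  moreover have "(a * b) powr (p / 2) \<le> (a powr p + b powr p) / 2"
  proof -
    have "0 \<le> (a powr (p / 2) - b powr (p / 2))\<^sup>2" by simp
    moreover have "(u powr (p / 2))\<^sup>2 = u powr p" if "0 < u" for u :: real
      using that by (simp add: power2_eq_square flip: powr_add)
    ultimately show ?thesis
      using pos by (simp add: power2_diff powr_mult algebra_simps)
  qed
  moreover have "a * b = (a * b) powr (1 - p / 2) * (a * b) powr (p / 2)"
    using pos by (simp flip: powr_add)
  ultimately show ?thesis
    using pos by (metis mult_mono powr_ge_zero)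
qed

lemma sum_correlation_le:
  assumes h: "h \<in> ell_ball p A" and p: "0 < p" "p \<le> 2" and \<pi>: "bij_betw \<pi> A A"
    and T: "finite T" "T \<subseteq> A" and small: "\<And>y. y \<in> T \<Longrightarrow> h y \<le> \<epsilon> \<or> h (\<pi> y) \<le> \<epsilon>"
  shows "(\<Sum>y\<in>T. h y * h (\<pi> y)) \<le> \<epsilon> powr (1 - p / 2)"
proof -
  have \<pi>A: "\<pi> y \<in> A" if "y \<in> A" for y using \<pi> that by (auto dest: bij_betwE)
  have inj: "inj_on \<pi> T" using \<pi> T by (meson bij_betw_def inj_on_subset)
  have "(\<Sum>y\<in>T. h y * h (\<pi> y)) \<le> (\<Sum>y\<in>T. \<epsilon> powr (1 - p / 2) * ((h y powr p + h (\<pi> y) powr p) / 2))"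
    using T p small ell_ball_nonneg[OF h] ell_ball_le_1[OF h p(1)] \<pi>A
    by (intro sum_mono mult_le_powr_mean) auto
  also have "\<dots> = \<epsilon> powr (1 - p / 2) * (((\<Sum>y\<in>T. h y powr p) + (\<Sum>y\<in>T. h (\<pi> y) powr p)) / 2)"
    by (simp add: sum.distrib flip: sum_distrib_left sum_divide_distrib)
  also have "(\<Sum>y\<in>T. h (\<pi> y) powr p) = (\<Sum>y\<in>\<pi> ` T. h y powr p)"
    by (simp add: sum.reindex[OF inj] o_def)
  also have "\<epsilon> powr (1 - p / 2) * (((\<Sum>y\<in>T. h y powr p) + (\<Sum>y\<in>\<pi> ` T. h y powr p)) / 2)
      \<le> \<epsilon> powr (1 - p / 2) * ((1 + 1) / 2)"
    using T \<pi>A by (intro mult_left_mono divide_right_mono add_mono ell_ball_sum_le[OF h]) auto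
  finally show ?thesis by simp
qed

lemma correlation_summable:
  assumes h: "h \<in> ell_ball p A" and p: "0 < p" "p \<le> 2" and \<pi>: "bij_betw \<pi> A A"
  shows "(\<lambda>y. h y * h (\<pi> y)) summable_on A"
proof (rule nonneg_bounded_partial_sums_imp_summable_on[where C = 1])
  show "0 \<le> h y * h (\<pi> y)" if "y \<in> A" for y
    using that \<pi> ell_ball_nonneg[OF h] by (auto dest: bij_betwE)
  have "(\<Sum>y\<in>T. h y * h (\<pi> y)) \<le> 1" if "finite T" "T \<subseteq> A" for T
    using sum_correlation_le[OF h p \<pi> that, of 1] ell_ball_le_1[OF h p(1)] that by auto
  then show "\<forall>\<^sub>F T in finite_subsets_at_top A. (\<Sum>y\<in>T. h y * h (\<pi> y)) \<le> 1"
    by (auto simp: eventually_finite_subsets_at_top intro!: exI[of _ "{}"])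
qed

text \<open>
  A term outside the truncated sum has a factor \<open>h y\<close> or \<open>h (\<pi> y)\<close> taken off \<open>S\<close>, hence at most
  \<open>\<epsilon>\<close>, so the error bound depends on \<open>h\<close> only through \<open>\<epsilon>\<close>.
\<close>

lemma correlation_truncation:
  assumes h: "h \<in> ell_ball p A" and p: "0 < p" "p \<le> 2" and \<pi>: "bij_betw \<pi> A A"
    and S: "finite S" "S \<subseteq> A" and small: "\<And>y. y \<in> A - S \<Longrightarrow> h y \<le> \<epsilon>"
  shows "\<bar>(\<Sum>\<^sub>\<infinity>y\<in>A. h y * h (\<pi> y)) - (\<Sum>y | y \<in> S \<and> \<pi> y \<in> S. h y * h (\<pi> y))\<bar> \<le> \<epsilon> powr (1 - p / 2)"
proof -
  let ?f = "\<lambda>y. h y * h (\<pi> y)" and ?B = "{y \<in> S. \<pi> y \<in> S}"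
  have \<pi>A: "\<pi> y \<in> A" if "y \<in> A" for y using \<pi> that by (auto dest: bij_betwE)
  have B: "finite ?B" "?B \<subseteq> A" using S by auto
  have sum: "?f summable_on A" by (rule correlation_summable[OF h p \<pi>])
  have sumB: "?f summable_on A - ?B" by (rule summable_on_subset[OF sum]) auto
  have "infsum ?f A = infsum ?f ?B + infsum ?f (A - ?B)"
    using B sum sumB infsum_Un_disjoint[of ?f ?B "A - ?B"]
    by (simp add: Un_absorb1 summable_on_finite)
  then have "infsum ?f A - sum ?f ?B = infsum ?f (A - ?B)" using B by simp
  moreover have "0 \<le> infsum ?f (A - ?B)"
    using ell_ball_nonneg[OF h] \<pi>A by (intro infsum_nonneg) auto
  moreover have "infsum ?f (A - ?B) \<le> \<epsilon> powr (1 - p / 2)"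
  proof (rule infsum_le_finite_sums[OF sumB])
    fix T assume T: "finite T" "T \<subseteq> A - ?B"
    have "h y \<le> \<epsilon> \<or> h (\<pi> y) \<le> \<epsilon>" if "y \<in> T" for y
      using T that small[of y] small[of "\<pi> y"] \<pi>A[of y] by blast
    then show "sum ?f T \<le> \<epsilon> powr (1 - p / 2)"
      using T by (intro sum_correlation_le[OF h p \<pi>]) auto
  qed
  ultimately show ?thesis by simp
qed

text \<open>
  In terms of an enumeration, the truncated correlation is determined by the values at the
  enumerated points and by which pairs of them are related by \<open>\<pi>\<close>. No other information about the
  position of the points enters, and this is what allows the points to be replaced in the limit.
\<close>

lemma sum_correlation_reindex:
  fixes x :: "nat \<Rightarrow> 'b" and K :: nat
  assumes "inj x"
  shows "(\<Sum>y | y \<in> x ` {..<K} \<and> \<pi> y \<in> x ` {..<K}. h y * h (\<pi> y))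
    = (\<Sum>k<K. \<Sum>l<K. if \<pi> (x k) = x l then h (x k) * h (x l) else (0::real))"
proof -
  have inner: "(\<Sum>l<K. if \<pi> (x k) = x l then h (x k) * h (x l) else 0)
      = (if \<pi> (x k) \<in> x ` {..<K} then h (x k) * h (\<pi> (x k)) else 0)" for k
  proof (cases "\<pi> (x k) \<in> x ` {..<K}")
    case True
    then obtain j where j: "j < K" "\<pi> (x k) = x j" by auto
    then have eq: "(\<pi> (x k) = x l) = (l = j)" for l using assms by (auto dest: injD)
    have "(\<Sum>l<K. if \<pi> (x k) = x l then h (x k) * h (x l) else 0)
        = (\<Sum>l\<in>{..<K}. if l = j then h (x k) * h (x l) else 0)" by (simp only: eq)
    also have "\<dots> = h (x k) * h (\<pi> (x k))" using j by (subst sum.delta) auto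
    finally show ?thesis using True by simp
  next
    case False
    then have "\<pi> (x k) \<noteq> x l" if "l < K" for l using that by auto
    then show ?thesis using False by (simp add: sum.neutral)
  qed
  have "{y. y \<in> x ` {..<K} \<and> \<pi> y \<in> x ` {..<K}} = x ` {k\<in>{..<K}. \<pi> (x k) \<in> x ` {..<K}}" by auto
  then have "(\<Sum>y | y \<in> x ` {..<K} \<and> \<pi> y \<in> x ` {..<K}. h y * h (\<pi> y))
    = (\<Sum>k\<in>{k\<in>{..<K}. \<pi> (x k) \<in> x ` {..<K}}. h (x k) * h (\<pi> (x k)))"
    using assms by (simp add: sum.reindex inj_on_subset[of x UNIV])
  also have "\<dots> = (\<Sum>k<K. if \<pi> (x k) \<in> x ` {..<K} then h (x k) * h (\<pi> (x k)) else 0)"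
    by (subst sum.inter_filter) auto
  finally show ?thesis using inner by simp
qed

text \<open>
  For fixed \<open>K\<close> the truncations to the first \<open>K\<close> points are finite sums of eventually constant
  shape, so they converge; the truncation error tends to 0 in \<open>K\<close> uniformly in \<open>n\<close>.
\<close>

lemma correlation_tendsto:
  fixes h :: "nat \<Rightarrow> 'b \<Rightarrow> real" and h' :: "'b \<Rightarrow> real" and x :: "nat \<Rightarrow> nat \<Rightarrow> 'b" and \<epsilon> :: "nat \<Rightarrow> real"
  assumes p: "0 < p" "p < 2" and \<pi>: "bij_betw \<pi> A A"
    and h: "\<And>n. h n \<in> ell_ball p A" and h': "h' \<in> ell_ball p A"
    and x: "\<And>n. inj (x n)" "\<And>n. range (x n) \<subseteq> A" and x': "inj x'" "range x' \<subseteq> A"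
    and \<epsilon>: "\<epsilon> \<longlonglongrightarrow> 0" "\<And>K. 0 \<le> \<epsilon> K"
    and tail: "\<And>n K y. y \<in> A - x n ` {..<K} \<Longrightarrow> h n y \<le> \<epsilon> K"
    and tail': "\<And>K y. y \<in> A - x' ` {..<K} \<Longrightarrow> h' y \<le> \<epsilon> K"
    and val: "\<And>k. (\<lambda>n. h n (x n k)) \<longlonglongrightarrow> h' (x' k)"
    and rel: "\<And>k l. \<forall>\<^sub>F n in sequentially. \<pi> (x n k) = x n l \<longleftrightarrow> \<pi> (x' k) = x' l"
  shows "(\<lambda>n. \<Sum>\<^sub>\<infinity>y\<in>A. h n y * h n (\<pi> y)) \<longlonglongrightarrow> (\<Sum>\<^sub>\<infinity>y\<in>A. h' y * h' (\<pi> y))"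
proof -
  define C where "C n = (\<Sum>\<^sub>\<infinity>y\<in>A. h n y * h n (\<pi> y))" for n
  define C' where "C' = (\<Sum>\<^sub>\<infinity>y\<in>A. h' y * h' (\<pi> y))"
  define t where "t K n = (\<Sum>k<K. \<Sum>l<K. if \<pi> (x n k) = x n l then h n (x n k) * h n (x n l) else 0)" for K n
  define t' where "t' K = (\<Sum>k<K. \<Sum>l<K. if \<pi> (x' k) = x' l then h' (x' k) * h' (x' l) else 0)" for K
  have p2: "p \<le> 2" using p by simp
  have C: "\<bar>C n - t K n\<bar> \<le> \<epsilon> K powr (1 - p / 2)" for K n
    unfolding C_def t_def sum_correlation_reindex[OF x(1), symmetric]
    by (rule correlation_truncation[OF h p(1) p2 \<pi>]) (use x(2)[of n] tail[of _ n K] in auto)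
  have C': "\<bar>C' - t' K\<bar> \<le> \<epsilon> K powr (1 - p / 2)" for K
    unfolding C'_def t'_def sum_correlation_reindex[OF x'(1), symmetric]
    by (rule correlation_truncation[OF h' p(1) p2 \<pi>]) (use x'(2) tail'[of _ K] in auto)
  have t: "t K \<longlonglongrightarrow> t' K" for K
    unfolding t_def t'_def
  proof (intro tendsto_sum)
    fix k l
    have "(\<lambda>n. if \<pi> (x' k) = x' l then h n (x n k) * h n (x n l) else 0)
        \<longlonglongrightarrow> (if \<pi> (x' k) = x' l then h' (x' k) * h' (x' l) else 0)"
      using val by (auto intro!: tendsto_intros)
    then show "(\<lambda>n. if \<pi> (x n k) = x n l then h n (x n k) * h n (x n l) else 0)
        \<longlonglongrightarrow> (if \<pi> (x' k) = x' l then h' (x' k) * h' (x' l) else 0)"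
      by (rule Lim_transform_eventually) (use rel[of k l] in eventually_elim, simp)
  qed
  have "(\<lambda>K. \<epsilon> K powr (1 - p / 2)) \<longlonglongrightarrow> 0"
    by (rule tendsto_zero_powrI[OF \<epsilon>(1) tendsto_const]) (use p \<epsilon>(2) in auto)
  have "C \<longlonglongrightarrow> C'"
  proof (rule LIMSEQ_I)
    fix r :: real assume r: "0 < r"
    with \<open>(\<lambda>K. \<epsilon> K powr (1 - p / 2)) \<longlonglongrightarrow> 0\<close> have "\<forall>\<^sub>F K in sequentially. \<epsilon> K powr (1 - p / 2) < r / 3"
      by (intro order_tendstoD) auto
    then obtain K where K: "\<epsilon> K powr (1 - p / 2) < r / 3"
      using eventually_happens' by force
    obtain N where N: "\<And>n. n \<ge> N \<Longrightarrow> \<bar>t K n - t' K\<bar> < r / 3"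
      using LIMSEQ_D[OF t, of "r / 3" K] r by auto
    have "\<bar>C n - C'\<bar> < r" if "n \<ge> N" for n
      using C[of n K] C'[of K] K N[OF that] by linarith
    then show "\<exists>N. \<forall>n\<ge>N. norm (C n - C') < r" by auto
  qed
  then show ?thesis by (simp add: C_def[abs_def] C'_def)
qed

section \<open>Relative positions in copies of a group\<close>

definition translate :: "('a, 'b) monoid_scheme \<Rightarrow> 'a \<Rightarrow> 'i \<times> 'a \<Rightarrow> 'i \<times> 'a" where
  "translate G s y = (fst y, snd y \<otimes>\<^bsub>G\<^esub> s)"

abbreviation copies :: "('a, 'b) monoid_scheme \<Rightarrow> (nat \<times> 'a) set" where
  "copies G \<equiv> UNIV \<times> carrier G"

context group
begin

lemma translate_one: "y \<in> copies G \<Longrightarrow> translate G \<one> y = y"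
  by (auto simp: translate_def)

lemma translate_translate:
  "y \<in> copies G \<Longrightarrow> s \<in> carrier G \<Longrightarrow> t \<in> carrier G \<Longrightarrow>
    translate G t (translate G s y) = translate G (s \<otimes> t) y"
  by (auto simp: translate_def m_assoc)

lemma translate_eq_iff:
  "y \<in> copies G \<Longrightarrow> s \<in> carrier G \<Longrightarrow> t \<in> carrier G \<Longrightarrow>
    translate G s y = translate G t y \<longleftrightarrow> s = t"
  by (auto simp: translate_def)

lemma bij_betw_translate:
  assumes "s \<in> carrier G"
  shows "bij_betw (translate G s) (copies G) (copies G)"
  by (rule bij_betw_byWitness[where f' = "translate G (inv s)"])
    (use assms in \<open>auto simp: translate_def m_assoc\<close>)

text \<open>
  Read \<open>E k l s\<close> as ``point \<open>l\<close> is the right translate by \<open>s\<close> of point \<open>k\<close>''. The hypotheses are the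
  properties that such relations have for distinct points, and they suffice to reconstruct points.
  Indices related by some \<open>s\<close> form a class; the class is placed in the copy numbered by its least
  element, which sits at the identity, and any other index sits at its position relative to that
  element. Copies whose number represents no class stay empty.
\<close>

lemma realize_relative_positions:
  fixes E :: "nat \<Rightarrow> nat \<Rightarrow> 'a \<Rightarrow> bool"
  assumes refl: "\<And>k. E k k \<one>"
    and sym: "\<And>k l s. s \<in> carrier G \<Longrightarrow> E k l s \<Longrightarrow> E l k (inv s)"
    and trans: "\<And>k l m s t. s \<in> carrier G \<Longrightarrow> t \<in> carrier G \<Longrightarrow> E k l s \<Longrightarrow> E l m t \<Longrightarrow> E k m (s \<otimes> t)"
    and func: "\<And>k l s t. s \<in> carrier G \<Longrightarrow> t \<in> carrier G \<Longrightarrow> E k l s \<Longrightarrow> E k l t \<Longrightarrow> s = t"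
    and inj: "\<And>k l. E k l \<one> \<Longrightarrow> k = l"
  obtains x :: "nat \<Rightarrow> nat \<times> 'a" where "inj x" "range x \<subseteq> copies G"
    "\<And>k l s. s \<in> carrier G \<Longrightarrow> translate G s (x k) = x l \<longleftrightarrow> E k l s"
proof -
  define rep where "rep k = (LEAST j. \<exists>s\<in>carrier G. E j k s)" for k
  define \<delta> where "\<delta> k = (SOME s. s \<in> carrier G \<and> E (rep k) k s)" for k
  have "\<exists>s\<in>carrier G. E (rep k) k s" for k
    unfolding rep_def by (rule LeastI_ex) (use refl in blast)
  then have \<delta>: "\<delta> k \<in> carrier G" "E (rep k) k (\<delta> k)" for k
    unfolding \<delta>_def by (smt (verit, best) someI)+
  have rep_eq: "rep k = rep l" if "s \<in> carrier G" "E k l s" for k l s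
  proof -
    \<comment> \<open>Related indices have the same set of relatives, hence the same least one.\<close>
    have "(\<exists>s\<in>carrier G. E j k s) = (\<exists>s\<in>carrier G. E j l s)" for j
      using trans[of _ s j k l] trans[of _ "inv s" j l k] sym[of s k l] that by (metis inv_closed m_closed)
    then show ?thesis by (simp add: rep_def)
  qed
  define x where "x k = (rep k, \<delta> k)" for k
  have x: "translate G s (x k) = x l \<longleftrightarrow> E k l s" if s: "s \<in> carrier G" for k l s
  proof
    assume "E k l s"
    then have "rep k = rep l" using rep_eq s by blast
    moreover from this have "\<delta> k \<otimes> s = \<delta> l"
      using trans[OF \<delta>(1) s \<delta>(2) \<open>E k l s\<close>] \<delta>[of l] by (intro func[of _ _ "rep l" l]) (auto simp: s \<delta>(1))
    ultimately show "translate G s (x k) = x l" by (simp add: translate_def x_def)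
  next
    assume "translate G s (x k) = x l"
    then have *: "rep k = rep l" "\<delta> l = \<delta> k \<otimes> s" by (auto simp: translate_def x_def)
    have "E k (rep k) (inv (\<delta> k))" using \<delta> sym by blast
    then have "E k l (inv (\<delta> k) \<otimes> \<delta> l)" using \<delta>[of l] \<delta>[of k] *(1) by (intro trans[of _ _ k "rep k" l]) auto
    also have "inv (\<delta> k) \<otimes> \<delta> l = s" using * \<delta>(1)[of k] s by (simp flip: m_assoc)
    finally show "E k l s" .
  qed
  have copies: "x k \<in> copies G" for k using \<delta> by (simp add: x_def)
  show thesis
  proof
    show "inj x"
      using x[of \<one>] translate_one[OF copies] inj by (intro injI) (metis one_closed)
    show "range x \<subseteq> copies G" using copies by blast
  qed (rule x)
qed

section \<open>Compactness of the set of correlations\<close>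

text \<open>
  The limit keeps values and relative positions of the enumerated points, as these are all that the
  truncated correlations depend on. Points whose relative position leaves every finite set end up
  in different copies of the group, and mass that spreads out over ever smaller values is lost, without effect on
  the correlations.
\<close>

lemma correlation_compactness:
  fixes h :: "nat \<Rightarrow> nat \<times> 'a \<Rightarrow> real"
  assumes countable: "countable (carrier G)" and p: "0 < p" "p < 2"
    and h: "\<And>n. h n \<in> ell_ball p (copies G)"
  obtains r :: "nat \<Rightarrow> nat" and h' where "strict_mono r" "h' \<in> ell_ball p (copies G)"
    "\<And>s. s \<in> carrier G \<Longrightarrow>
      (\<lambda>n. \<Sum>\<^sub>\<infinity>y\<in>copies G. h (r n) y * h (r n) (translate G s y))
        \<longlonglongrightarrow> (\<Sum>\<^sub>\<infinity>y\<in>copies G. h' y * h' (translate G s y))"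
proof -
  let ?A = "copies G"
  define \<epsilon> where "\<epsilon> K = real (Suc K) powr (- (1 / p))" for K :: nat
  have "infinite ?A" using finite_cartesian_productD1[of UNIV "carrier G"] by auto
  have "\<exists>x :: nat \<Rightarrow> nat \<times> 'a. inj x \<and> range x \<subseteq> ?A \<and> (\<forall>k. \<forall>y\<in>?A - x ` {..<k}. h n y \<le> h n (x k))" for n
  proof (rule decreasing_enumeration[OF \<open>infinite ?A\<close>, of "h n"])
    show "finite {y \<in> ?A. e \<le> h n y}" if "0 < e" for e
      by (rule ell_ball_finite_superlevel[OF h p(1) that])
    show "0 \<le> h n y" if "y \<in> ?A" for y by (rule ell_ball_nonneg[OF h that])
    fix x :: "nat \<Rightarrow> nat \<times> 'a" assume *: "inj x" "range x \<subseteq> ?A"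
      "\<And>k y. y \<in> ?A - x ` {..<k} \<Longrightarrow> h n y \<le> h n (x k)"
    then show ?thesis by blast
  qed
  then obtain x :: "nat \<Rightarrow> nat \<Rightarrow> nat \<times> 'a" where x: "\<And>n. inj (x n)" "\<And>n. range (x n) \<subseteq> ?A"
    and dec: "\<And>n k y. y \<in> ?A - x n ` {..<k} \<Longrightarrow> h n y \<le> h n (x n k)" by metis
  have xA: "x n k \<in> ?A" for n k using x(2) by auto
  have antimono: "h n (x n l) \<le> h n (x n k)" if "k \<le> l" for n k l
  proof (rule dec)
    have "x n l \<noteq> x n j" if "j < k" for j using injD[OF x(1), of n l j] that \<open>k \<le> l\<close> by linarith
    then show "x n l \<in> ?A - x n ` {..<k}" using xA by auto
  qed
  have \<epsilon>: "h n (x n k) \<le> \<epsilon> k" for n k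
  proof -
    have "h n (x n k) \<le> h n y" if "y \<in> x n ` {..k}" for y
      using that antimono by auto
    moreover have "card (x n ` {..k}) = Suc k"
      using x(1)[of n] by (simp add: card_image inj_on_subset[of "x n" UNIV])
    ultimately show ?thesis
      using ell_ball_le_root[OF h[of n] p(1), of "x n ` {..k}" "h n (x n k)"] xA ell_ball_nonneg[OF h xA]
      by (simp add: \<epsilon>_def image_subset_iff)
  qed
  \<comment> \<open>All data whose convergence is needed, as one bounded family over a countable index set; the
  boolean is coded as 0 or 1, so that its convergence means that it is eventually constant.\<close>
  define b :: "nat \<Rightarrow> nat \<times> nat \<times> 'a \<Rightarrow> real \<times> real" where
    "b n = (\<lambda>(k, l, s). (h n (x n k), of_bool (translate G s (x n k) = x n l)))" for n
  have bound: "norm (b n z) \<le> 2" for n z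
  proof -
    obtain k l s where z: "z = (k, l, s)" by (cases z)
    have "norm (b n z) \<le> norm (h n (x n k)) + norm (of_bool (translate G s (x n k) = x n l) :: real)"
      unfolding b_def z prod.case by (rule norm_Pair_le)
    also have "\<dots> \<le> 1 + 1"
      using ell_ball_le_1[OF h p(1) xA] ell_ball_nonneg[OF h xA] by (intro add_mono) auto
    finally show ?thesis by simp
  qed
  obtain r :: "nat \<Rightarrow> nat" where r: "strict_mono r"
    "\<And>z. z \<in> UNIV \<times> UNIV \<times> carrier G \<Longrightarrow> \<exists>L. (\<lambda>n. b (r n) z) \<longlonglongrightarrow> L"
    using function_convergent_subsequence[of "UNIV \<times> UNIV \<times> carrier G" b 2] bound countable
    by (metis countableI_type countable_SIGMA)
  define E where "E k l s \<longleftrightarrow> (\<forall>\<^sub>F n in sequentially. translate G s (x (r n) k) = x (r n) l)" for k l s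
  have not_E: "\<forall>\<^sub>F n in sequentially. translate G s (x (r n) k) \<noteq> x (r n) l"
    if s: "s \<in> carrier G" and "\<not> E k l s" for k l s
  proof -
    obtain L where L: "(\<lambda>n. b (r n) (k, l, s)) \<longlonglongrightarrow> L" using r(2)[of "(k, l, s)"] s by auto
    have lim: "(\<lambda>n. of_bool (translate G s (x (r n) k) = x (r n) l) :: real) \<longlonglongrightarrow> snd L"
      using tendsto_snd[OF L] by (simp add: b_def)
    show ?thesis
    proof (cases "0 < snd L")
      case True
      with lim have "\<forall>\<^sub>F n in sequentially. 0 < (of_bool (translate G s (x (r n) k) = x (r n) l) :: real)"
        by (rule order_tendstoD)
      then have "E k l s" unfolding E_def by eventually_elim simp
      then show ?thesis using \<open>\<not> E k l s\<close> by simp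
    next
      case False
      then have "snd L < 1" by simp
      with lim have "\<forall>\<^sub>F n in sequentially. (of_bool (translate G s (x (r n) k) = x (r n) l) :: real) < 1"
        by (rule order_tendstoD)
      then show ?thesis by eventually_elim simp
    qed
  qed
  have "\<exists>a. (\<lambda>n. h (r n) (x (r n) k)) \<longlonglongrightarrow> a" for k
  proof -
    obtain L where "(\<lambda>n. b (r n) (k, 0, \<one>)) \<longlonglongrightarrow> L" using r(2)[of "(k, 0, \<one>)"] by auto
    from tendsto_fst[OF this] show ?thesis by (auto simp: b_def)
  qed
  then obtain a where a: "\<And>k. (\<lambda>n. h (r n) (x (r n) k)) \<longlonglongrightarrow> a k" by metis
  \<comment> \<open>The realization hypotheses on \<open>E\<close> hold for the points \<open>x (r n)\<close> at every single \<open>n\<close>; a relation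
  between fixed objects that holds for almost all \<open>n\<close> holds.\<close>
  have E_const: "P" if "\<forall>\<^sub>F n in sequentially. P" for P using that by simp
  obtain x' :: "nat \<Rightarrow> nat \<times> 'a" where x': "inj x'" "range x' \<subseteq> ?A"
    "\<And>k l s. s \<in> carrier G \<Longrightarrow> translate G s (x' k) = x' l \<longleftrightarrow> E k l s"
  proof (rule realize_relative_positions[of E])
    show "E k k \<one>" for k by (simp add: E_def translate_one[OF xA])
    show "E l k (inv s)" if s: "s \<in> carrier G" and "E k l s" for k l s
      using \<open>E k l s\<close> unfolding E_def
    proof eventually_elim
      case (elim n)
      then show ?case using translate_translate[OF xA, of s "inv s" "r n" k] translate_one[OF xA] s by simp
    qed
    show "E k m (s \<otimes> t)" if st: "s \<in> carrier G" "t \<in> carrier G" and "E k l s" "E l m t" for k l m s t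
      using \<open>E k l s\<close> \<open>E l m t\<close> unfolding E_def
    proof eventually_elim
      case (elim n)
      then show ?case using translate_translate[OF xA st, of "r n" k] by simp
    qed
    show "s = t" if st: "s \<in> carrier G" "t \<in> carrier G" and "E k l s" "E k l t" for k l s t
    proof (rule E_const)
      show "\<forall>\<^sub>F n in sequentially. s = t"
        using \<open>E k l s\<close> \<open>E k l t\<close> unfolding E_def
        by eventually_elim (use translate_eq_iff[OF xA st] in metis)
    qed
    show "k = l" if "E k l \<one>" for k l
    proof (rule E_const)
      show "\<forall>\<^sub>F n in sequentially. k = l"
        using \<open>E k l \<one>\<close> unfolding E_def
        by eventually_elim (use translate_one[OF xA] injD[OF x(1)] in metis)
    qed
  qed blast
  define h' where "h' y = (if y \<in> range x' then a (the_inv x' y) else 0)" for y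
  have h'_x': "h' (x' k) = a k" for k
    using the_inv_f_f[OF x'(1)] by (simp add: h'_def)
  have a_bounds: "0 \<le> a k" "a k \<le> \<epsilon> k" for k
    using LIMSEQ_le_const[OF a] LIMSEQ_le_const2[OF a] ell_ball_nonneg[OF h xA] \<epsilon> by blast+
  have a_dec: "a l \<le> a k" if "k \<le> l" for k l
    by (rule LIMSEQ_le[OF a a]) (use antimono[OF that] in blast)
  have sum_a: "(\<Sum>k<K. a k powr p) \<le> 1" for K
  proof (rule LIMSEQ_le_const2)
    show "(\<lambda>n. \<Sum>k<K. h (r n) (x (r n) k) powr p) \<longlonglongrightarrow> (\<Sum>k<K. a k powr p)"
    proof (intro tendsto_sum)
      fix k show "(\<lambda>n. h (r n) (x (r n) k) powr p) \<longlonglongrightarrow> a k powr p"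
        using p ell_ball_nonneg[OF h xA]
        by (intro tendsto_powr'[OF a tendsto_const]) (auto intro: always_eventually)
    qed
    have "(\<Sum>k<K. h n (x n k) powr p) = (\<Sum>y\<in>x n ` {..<K}. h n y powr p)" for n
      using x(1)[of n] by (simp add: sum.reindex inj_on_subset[of "x n" UNIV])
    then show "\<exists>N. \<forall>n\<ge>N. (\<Sum>k<K. h (r n) (x (r n) k) powr p) \<le> 1"
      using ell_ball_sum_le[OF h] xA by (simp add: image_subset_iff)
  qed
  have h': "h' \<in> ell_ball p ?A"
    unfolding ell_ball_def
  proof (intro CollectI conjI ballI allI impI)
    show "0 \<le> h' y" for y using a_bounds by (simp add: h'_def)
    fix T :: "(nat \<times> 'a) set" assume T: "finite T"
    \<comment> \<open>All points of \<open>T\<close> at which \<open>h'\<close> can be nonzero are among finitely many \<open>x' k\<close>.\<close>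
    obtain K where K: "x' -` T \<subseteq> {..<K}"
      using finite_vimageI[OF T x'(1)] by (meson finite_nat_iff_bounded)
    have "(\<Sum>y\<in>T. h' y powr p) = (\<Sum>y\<in>x' ` (x' -` T). h' y powr p)"
      by (rule sum.mono_neutral_right[OF T]) (auto simp: h'_def)
    also have "\<dots> = (\<Sum>k\<in>x' -` T. a k powr p)"
      using x'(1) by (subst sum.reindex) (auto simp: inj_on_subset[of x' UNIV] h'_x')
    also have "\<dots> \<le> (\<Sum>k<K. a k powr p)" using K by (intro sum_mono2) auto
    also have "\<dots> \<le> 1" by (rule sum_a)
    finally show "(\<Sum>y\<in>T. h' y powr p) \<le> 1" .
  qed
  show thesis
  proof (rule that[OF r(1) h'])
    fix s assume s: "s \<in> carrier G"
    show "(\<lambda>n. \<Sum>\<^sub>\<infinity>y\<in>?A. h (r n) y * h (r n) (translate G s y))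
        \<longlonglongrightarrow> (\<Sum>\<^sub>\<infinity>y\<in>?A. h' y * h' (translate G s y))"
    proof (rule correlation_tendsto[where x = "\<lambda>n. x (r n)" and x' = x' and \<epsilon> = \<epsilon>])
      show "\<epsilon> \<longlonglongrightarrow> 0"
        unfolding \<epsilon>_def using p
        by (intro tendsto_neg_powr filterlim_compose[OF filterlim_real_sequentially filterlim_Suc]) auto
      show "h (r n) y \<le> \<epsilon> K" if "y \<in> ?A - x (r n) ` {..<K}" for n K y
        using dec[OF that] \<epsilon>[of "r n" K] by linarith
      show "h' y \<le> \<epsilon> K" if y: "y \<in> ?A - x' ` {..<K}" for K y
      proof (cases "y \<in> range x'")
        case True
        then obtain l where "y = x' l" by blast
        moreover from this y have "K \<le> l" by (metis DiffD2 imageI lessThan_iff not_less)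
        ultimately show ?thesis using a_dec[of K l] a_bounds(2)[of K] by (simp add: h'_x')
      qed (simp add: h'_def \<epsilon>_def)
      show "(\<lambda>n. h (r n) (x (r n) k)) \<longlonglongrightarrow> h' (x' k)" for k using a by (simp add: h'_x')
      show "\<forall>\<^sub>F n in sequentially. (translate G s (x (r n) k) = x (r n) l) = (translate G s (x' k) = x' l)" for k l
      proof (cases "E k l s")
        case True
        then show ?thesis unfolding E_def by eventually_elim (use x'(3)[OF s] True in simp)
      next
        case False
        show ?thesis using not_E[OF s False] by eventually_elim (use x'(3)[OF s] False in simp)
      qed
      show "0 \<le> \<epsilon> K" for K by (simp add: \<epsilon>_def)
    qed (fact p bij_betw_translate[OF s] h h' x x')+
  qed
qed

end

section \<open>Series of autocorrelations as correlations on the copies\<close>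

lemma has_sum_finite_sum:
  fixes f :: "'i \<Rightarrow> 'b \<Rightarrow> 'c :: topological_comm_monoid_add"
  assumes "finite I" "\<And>i. i \<in> I \<Longrightarrow> (f i has_sum S i) A"
  shows "((\<lambda>y. \<Sum>i\<in>I. f i y) has_sum (\<Sum>i\<in>I. S i)) A"
  using assms by (induction I rule: finite_induct) (auto intro: has_sum_add)

context group
begin

text \<open>
  Any finite set of points lies in a product of finite sets, over which the sum of powers is at
  most \<open>\<Sum>\<^sub>i \<parallel>f\<^sub>i\<parallel>\<^sub>p\<^sup>p\<close>.
\<close>

lemma ell_ball_of_Phi_series:
  assumes p: "1 \<le> p" and f: "is_Phi_series G p f \<phi>"
  shows "(\<lambda>(i, t). cmod (f i t)) \<in> ell_ball p (copies G)"
proof -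
  define N where "N i = (\<Sum>\<^sub>\<infinity>t\<in>carrier G. cmod (f i t) powr p)" for i
  have N0: "0 \<le> N i" for i unfolding N_def by (intro infsum_nonneg) auto
  then have lp: "lp_norm G p (f i) powr p = N i" for i
    using p by (simp add: lp_norm_def powr_powr flip: N_def)
  have sum: "(\<lambda>t. cmod (f i t) powr p) summable_on carrier G" for i
    using f by (simp add: is_Phi_series_def M_le1_def)
  have N: "summable N" "suminf N \<le> 1" using f by (simp_all add: is_Phi_series_def lp)
  show ?thesis
    unfolding ell_ball_def
  proof (intro CollectI conjI allI impI ballI)
    fix T :: "(nat \<times> 'a) set" assume T: "T \<subseteq> copies G" "finite T"
    define I where "I = fst ` T"
    define S where "S = snd ` T"
    have IS: "finite I" "finite S" "S \<subseteq> carrier G" "T \<subseteq> I \<times> S"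
      using T by (auto simp: I_def S_def image_subset_iff intro!: rev_image_eqI)
    have "(\<Sum>y\<in>T. (case y of (i, t) \<Rightarrow> cmod (f i t)) powr p)
        \<le> (\<Sum>y\<in>I \<times> S. (case y of (i, t) \<Rightarrow> cmod (f i t)) powr p)"
      using IS by (intro sum_mono2) auto
    also have "\<dots> = (\<Sum>i\<in>I. \<Sum>t\<in>S. cmod (f i t) powr p)"
      by (simp add: sum.cartesian_product split_def)
    also have "\<dots> \<le> (\<Sum>i\<in>I. N i)"
      unfolding N_def using IS sum by (intro sum_mono finite_sum_le_infsum) auto
    also have "\<dots> \<le> suminf N"
      using N(1) IS(1) N0 by (intro sum_le_suminf) auto
    finally show "(\<Sum>y\<in>T. (case y of (i, t) \<Rightarrow> cmod (f i t)) powr p) \<le> 1" using N(2) by simp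
  qed auto
qed

text \<open>
  Fubini for the absolutely convergent double sum over copies and group elements.
\<close>

lemma Phi_sums_correlation:
  assumes p: "0 < p" "p \<le> 2" and h: "h \<in> ell_ball p (copies G)"
    and f: "\<And>i t. t \<in> carrier G \<Longrightarrow> f i t = complex_of_real (h (i, t))" and s: "s \<in> carrier G"
  shows "(\<lambda>i. Phi G (f i) s) sums complex_of_real (\<Sum>\<^sub>\<infinity>y\<in>copies G. h y * h (translate G s y))"
proof -
  let ?c = "\<lambda>y. h y * h (translate G s y)"
  have sum: "?c summable_on copies G"
    by (rule correlation_summable[OF h p bij_betw_translate[OF s]])
  then have sum_i: "(\<lambda>t. ?c (i, t)) summable_on carrier G" for i
    using summable_on_SigmaD1[of "\<lambda>i t. ?c (i, t)" UNIV "\<lambda>_. carrier G" i] by (simp add: split_def)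
  have "((\<lambda>i. \<Sum>\<^sub>\<infinity>t\<in>carrier G. ?c (i, t)) has_sum infsum ?c (copies G)) UNIV"
    by (rule has_sum_SigmaD[where B = "\<lambda>_. carrier G" and f = ?c])
      (use sum sum_i in \<open>auto intro: has_sum_infsum\<close>)
  then have "((\<lambda>i. complex_of_real (\<Sum>\<^sub>\<infinity>t\<in>carrier G. ?c (i, t))) has_sum
      complex_of_real (infsum ?c (copies G))) UNIV"
    by (rule has_sum_of_real)
  moreover have "Phi G (f i) s = complex_of_real (\<Sum>\<^sub>\<infinity>t\<in>carrier G. ?c (i, t))" for i
  proof -
    have "Phi G (f i) s = (\<Sum>\<^sub>\<infinity>t\<in>carrier G. complex_of_real (?c (i, t)))"
      unfolding Phi_def by (rule infsum_cong) (use f s in \<open>simp add: translate_def\<close>)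
    also have "\<dots> = complex_of_real (\<Sum>\<^sub>\<infinity>t\<in>carrier G. ?c (i, t))"
      by (rule infsumI) (rule has_sum_of_real[OF has_sum_infsum[OF sum_i]])
    finally show ?thesis .
  qed
  ultimately show ?thesis by (simp add: has_sum_imp_sums)
qed

text \<open>
  The functions in \<^const>\<open>M_le1\<close> have values in \<open>[0,1]\<close> on the group, so they are recovered from
  their absolute values, which form the real function \<open>h\<close> on the copies.
\<close>

lemma Phi_series_eq_correlation:
  assumes p: "1 \<le> p" "p \<le> 2" and f: "is_Phi_series G p f \<phi>" and s: "s \<in> carrier G"
  defines "h \<equiv> \<lambda>(i, t). cmod (f i t)"
  shows "\<phi> s = complex_of_real (\<Sum>\<^sub>\<infinity>y\<in>copies G. h y * h (translate G s y))"
proof -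
  have "f i t = complex_of_real (h (i, t))" if "t \<in> carrier G" for i t
  proof -
    have "f i t \<in> complex_of_real ` {0..1}"
      using f that by (auto simp: is_Phi_series_def M_le1_def)
    then show ?thesis by (auto simp: h_def)
  qed
  then have "(\<lambda>i. Phi G (f i) s) sums complex_of_real (\<Sum>\<^sub>\<infinity>y\<in>copies G. h y * h (translate G s y))"
    using p ell_ball_of_Phi_series[OF p(1) f] s by (intro Phi_sums_correlation[of p]) (auto simp: h_def)
  moreover have "(\<lambda>i. Phi G (f i) s) sums \<phi> s" using f s by (simp add: is_Phi_series_def)
  ultimately show ?thesis by (rule sums_unique2[symmetric])
qed

text \<open>
  Conversely, the restrictions of \<open>h\<close> to the copies form an admissible sequence: membership in the
  ball bounds the values by 1, the norm of every restriction by 1, and the sum of the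
  \<open>p\<close>-th powers of these norms by 1.
\<close>

lemma Phi_series_of_ell_ball:
  assumes p: "1 \<le> p" "p \<le> 2" and h: "h \<in> ell_ball p (copies G)"
  shows "is_Phi_series G p (\<lambda>i t. complex_of_real (h (i, t)))
    (\<lambda>s. complex_of_real (\<Sum>\<^sub>\<infinity>y\<in>copies G. h y * h (translate G s y)))"
proof -
  let ?f = "\<lambda>i t. complex_of_real (h (i, t))"
  define N where "N i = (\<Sum>\<^sub>\<infinity>t\<in>carrier G. h (i, t) powr p)" for i
  have p0: "0 < p" using p by simp
  have abs: "\<bar>h (i, t)\<bar> = h (i, t)" if "t \<in> carrier G" for i t
    using ell_ball_nonneg[OF h, of "(i, t)"] that by simp
  have sum: "(\<lambda>y. h y powr p) summable_on copies G"
    by (rule ell_ball_powr_summable[OF h order_refl])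
  have sum_i: "(\<lambda>t. h (i, t) powr p) summable_on carrier G" for i
    using summable_on_SigmaD1[of "\<lambda>i t. h (i, t) powr p" UNIV "\<lambda>_. carrier G" i] sum
    by (simp add: split_def)
  have "(N has_sum (\<Sum>\<^sub>\<infinity>y\<in>copies G. h y powr p)) UNIV"
    unfolding N_def
    by (rule has_sum_SigmaD[where B = "\<lambda>_. carrier G" and f = "\<lambda>y. h y powr p"])
      (use sum sum_i in \<open>auto intro: has_sum_infsum\<close>)
  then have N: "N sums (\<Sum>\<^sub>\<infinity>y\<in>copies G. h y powr p)" by (rule has_sum_imp_sums)
  have "(\<Sum>\<^sub>\<infinity>y\<in>copies G. h y powr p) \<le> 1"
    by (rule infsum_le_finite_sums[OF sum]) (rule ell_ball_sum_le[OF h])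
  with N have N1: "summable N" "suminf N \<le> 1" by (simp_all add: sums_iff)
  have N0: "0 \<le> N i" for i unfolding N_def by (intro infsum_nonneg) auto
  have norm: "lp_norm G p (?f i) = N i powr (1 / p)" for i
    by (simp add: lp_norm_def N_def abs cong: infsum_cong)
  then have normp: "lp_norm G p (?f i) powr p = N i" for i
    using N0 p0 by (simp add: powr_powr)
  have "N i \<le> suminf N" for i
    using sum_le_suminf[OF N1(1), of "{i}"] N0 by simp
  then have "N i \<le> 1" for i using N1(2) order_trans by blast
  then have "N i powr (1 / p) \<le> 1" for i
    using N0 p0 by (intro powr_le1) auto
  moreover have "(\<lambda>t. cmod (?f i t) powr p) summable_on carrier G" for i
    by (rule summable_on_cong[THEN iffD1, OF _ sum_i[of i]]) (simp add: abs)
  ultimately have "?f i \<in> M_le1 G p" for i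
    using ell_ball_nonneg[OF h] ell_ball_le_1[OF h p0] by (auto simp: M_le1_def norm)
  then show ?thesis
    unfolding is_Phi_series_def normp using N1 Phi_sums_correlation[OF p0 p(2) h] by auto
qed

text \<open>
  Substituting \<open>y \<mapsto> y\<cdot>s\<close>, which permutes the points, gives
  \<open>\<phi>(s\<inverse>t) = \<Sum>\<^sub>y h(y\<cdot>s) h(y\<cdot>t)\<close>. So \<open>\<phi>(s\<inverse>t)\<close> is a Gram matrix, and its quadratic form at \<open>c\<close> is
  \<open>\<Sum>\<^sub>y \<bar>\<Sum>\<^sub>t c(t) h(y\<cdot>t)\<bar>\<^sup>2\<close>.
\<close>

lemma correlation_positive_definite:
  assumes p: "0 < p" "p \<le> 2" and h: "h \<in> ell_ball p (copies G)"
  shows "positive_definite G (\<lambda>s. complex_of_real (\<Sum>\<^sub>\<infinity>y\<in>copies G. h y * h (translate G s y)))"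
  unfolding positive_definite_def positive_matrix_on_def
proof (intro allI impI)
  fix I :: "'a set" and c :: "'a \<Rightarrow> complex"
  assume I: "finite I" "I \<subseteq> carrier G"
  let ?C = "\<lambda>s. \<Sum>\<^sub>\<infinity>y\<in>copies G. h y * h (translate G s y)"
  define g where "g s y = complex_of_real (h (translate G s y))" for s y
  have "((\<lambda>y. g s y * g t y) has_sum complex_of_real (?C (inv s \<otimes> t))) (copies G)"
    if st: "s \<in> I" "t \<in> I" for s t
  proof -
    have carr: "s \<in> carrier G" "t \<in> carrier G" using st I by auto
    have "((\<lambda>y. h y * h (translate G (inv s \<otimes> t) y)) has_sum ?C (inv s \<otimes> t)) (copies G)"
      by (intro has_sum_infsum correlation_summable[OF h p] bij_betw_translate) (use carr in auto)
    then have "((\<lambda>y. h (translate G s y) * h (translate G (inv s \<otimes> t) (translate G s y)))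
        has_sum ?C (inv s \<otimes> t)) (copies G)"
      by (subst has_sum_reindex_bij_betw[OF bij_betw_translate[OF carr(1)],
            of "\<lambda>y. h y * h (translate G (inv s \<otimes> t) y)"])
    then have "((\<lambda>y. h (translate G s y) * h (translate G t y)) has_sum ?C (inv s \<otimes> t)) (copies G)"
      by (rule has_sum_cong[THEN iffD1, rotated])
        (use carr in \<open>simp add: translate_translate flip: m_assoc\<close>)
    from has_sum_of_real[OF this] show ?thesis by (simp add: g_def)
  qed
  then have "((\<lambda>y. \<Sum>s\<in>I. \<Sum>t\<in>I. cnj (c s) * (g s y * g t y) * c t) has_sum
      (\<Sum>s\<in>I. \<Sum>t\<in>I. cnj (c s) * complex_of_real (?C (inv s \<otimes> t)) * c t)) (copies G)"
    using I by (intro has_sum_finite_sum has_sum_cmult_left has_sum_cmult_right) auto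
  moreover have "(\<Sum>s\<in>I. \<Sum>t\<in>I. cnj (c s) * (g s y * g t y) * c t)
      = complex_of_real ((cmod (\<Sum>t\<in>I. c t * g t y))\<^sup>2)" for y
  proof -
    have "(\<Sum>s\<in>I. \<Sum>t\<in>I. cnj (c s) * (g s y * g t y) * c t)
        = cnj (\<Sum>t\<in>I. c t * g t y) * (\<Sum>t\<in>I. c t * g t y)"
      unfolding cnj_sum sum_product by (intro sum.cong refl) (simp add: g_def)
    also have "\<dots> = complex_of_real ((cmod (\<Sum>t\<in>I. c t * g t y))\<^sup>2)"
      by (subst complex_norm_square) (rule mult.commute)
    finally show ?thesis .
  qed
  ultimately have sq: "((\<lambda>y. complex_of_real ((cmod (\<Sum>t\<in>I. c t * g t y))\<^sup>2)) has_sum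
      (\<Sum>s\<in>I. \<Sum>t\<in>I. cnj (c s) * complex_of_real (?C (inv s \<otimes> t)) * c t)) (copies G)"
    (is "(_ has_sum ?Q) _") by simp
  have "0 \<le> Re ?Q" by (rule has_sum_nonneg[OF has_sum_Re[OF sq]]) simp
  moreover have "Im ?Q = 0" using has_sum_unique[OF has_sum_Im[OF sq]] by simp
  ultimately show "?Q \<in> \<real>\<^sub>\<ge>\<^sub>0" by (simp add: complex_nonneg_Reals_iff)
qed

end

section \<open>Existence of a minimizer\<close>

text \<open>
  A single function is the series with all other terms zero; its norm constraint is \<open>\<parallel>f\<parallel>\<^sub>p\<^sup>p \<le> 1\<close>.
\<close>

lemma Phi_series_of_P_set:
  assumes p: "1 \<le> p" and \<psi>: "\<psi> \<in> P_set G p"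
  shows "\<exists>f. is_Phi_series G p f \<psi>"
proof -
  obtain f where f: "f \<in> M_le1 G p" and \<psi>_eq: "\<psi> = Phi G f" using \<psi> by (auto simp: P_set_def)
  define g where "g i = (if i = 0 then f else (\<lambda>_. 0))" for i :: nat
  have zero: "(\<lambda>_. 0) \<in> M_le1 G p" "lp_norm G p (\<lambda>_. 0) = 0" "Phi G (\<lambda>_. 0) s = 0" for s
    by (auto simp: M_le1_def lp_norm_def Phi_def)
  have norm: "(\<lambda>i. lp_norm G p (g i) powr p) sums (lp_norm G p f powr p)"
    using sums_If_finite_set[of "{0}" "\<lambda>_. lp_norm G p f powr p"]
    by (simp add: g_def zero if_distrib[of "lp_norm G p"] if_distrib[of "\<lambda>x. x powr p"] cong: if_cong)
  have "(\<lambda>i. Phi G (g i) s) sums \<psi> s" for s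
    using sums_single[of 0 "\<lambda>_. \<psi> s"] by (simp add: g_def \<psi>_eq zero if_distrib[of "\<lambda>f. Phi G f s"] cong: if_cong)
  moreover have "lp_norm G p f powr p \<le> 1"
    using f p by (intro powr_le1) (auto simp: M_le1_def lp_norm_def)
  moreover have "g i \<in> M_le1 G p" for i using f zero by (simp add: g_def)
  ultimately have "is_Phi_series G p g \<psi>"
    using norm by (auto simp: is_Phi_series_def sums_iff)
  then show ?thesis by blast
qed

theorem corollary1p3:
  fixes G :: "('a, 'b) monoid_scheme" and p :: real and F :: "'a set"
  assumes "group G" and "countable (carrier G)"
    and "1 \<le> p" and "p < 2"
    and "finite F" and "F \<subseteq> carrier G"
  shows "\<exists>f \<phi>. is_Phi_series G p f \<phi> \<and> positive_definite G \<phi> \<and>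
           (\<forall>g \<psi>. is_Phi_series G p g \<psi> \<longrightarrow> dist_on F \<phi> (\<lambda>_. 1) \<le> dist_on F \<psi> (\<lambda>_. 1)) \<and>
           (\<forall>\<psi>\<in>P_set G p. dist_on F \<phi> (\<lambda>_. 1) \<le> dist_on F \<psi> (\<lambda>_. 1))"
proof -
  interpret group G by fact
  have p: "0 < p" "p \<le> 2" using assms by auto
  let ?A = "copies G"
  let ?D = "\<lambda>\<psi>. dist_on F \<psi> (\<lambda>_. 1)"
  define C where "C h = (\<lambda>s. complex_of_real (\<Sum>\<^sub>\<infinity>y\<in>?A. h y * h (translate G s y)))" for h :: "nat \<times> 'a \<Rightarrow> real"
  have dist_cong: "?D \<psi> = ?D \<eta>" if "\<And>s. s \<in> F \<Longrightarrow> \<psi> s = \<eta> s" for \<psi> \<eta>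
    using that by (simp add: dist_on_def cong: image_cong)
  have series_C: "\<exists>h\<in>ell_ball p ?A. ?D \<psi> = ?D (C h)" if g: "is_Phi_series G p g \<psi>" for g \<psi>
    using ell_ball_of_Phi_series[OF assms(3) g] Phi_series_eq_correlation[OF assms(3) p(2) g] assms(6)
    by (intro bexI[of _ "\<lambda>(i, t). cmod (g i t)"] dist_cong) (auto simp: C_def)
  \<comment> \<open>For empty \<open>F\<close> the distance is a supremum over the empty set, hence the same for all functions
  but not known to be nonnegative; the argument with the infimum is for nonempty \<open>F\<close>.\<close>
  have "\<exists>h'\<in>ell_ball p ?A. \<forall>h\<in>ell_ball p ?A. ?D (C h') \<le> ?D (C h)"
  proof (cases "F = {}")
    case True
    moreover have "(\<lambda>_. 0) \<in> ell_ball p ?A" by (simp add: ell_ball_def)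
    ultimately show ?thesis by (auto simp: dist_on_def)
  next
    case False
    have point: "cmod (\<psi> s - 1) \<le> ?D \<psi>" if "s \<in> F" for s \<psi>
      unfolding dist_on_def using that assms(5) by (intro cSUP_upper) auto
    have D0: "0 \<le> ?D \<psi>" for \<psi>
      using False point norm_ge_zero order_trans by (metis all_not_in_conv)
    let ?V = "(\<lambda>h. ?D (C h)) ` ell_ball p ?A"
    have V: "?V \<noteq> {}" "bdd_below ?V"
    proof -
      have "(\<lambda>_. 0) \<in> ell_ball p ?A" by (simp add: ell_ball_def)
      then show "?V \<noteq> {}" by blast
      show "bdd_below ?V" using D0 by (intro bdd_belowI2[of _ 0]) auto
    qed
    have "\<exists>h\<in>ell_ball p ?A. ?D (C h) < Inf ?V + 1 / real (Suc n)" for n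
      using cInf_lessD[OF V(1), of "Inf ?V + 1 / real (Suc n)"] by auto
    then obtain h where h: "\<And>n. h n \<in> ell_ball p ?A"
      "\<And>n. ?D (C (h n)) < Inf ?V + 1 / real (Suc n)" by metis
    obtain r h' where r: "strict_mono r" and h': "h' \<in> ell_ball p ?A"
      and lim: "\<And>s. s \<in> carrier G \<Longrightarrow>
        (\<lambda>n. \<Sum>\<^sub>\<infinity>y\<in>?A. h (r n) y * h (r n) (translate G s y))
          \<longlonglongrightarrow> (\<Sum>\<^sub>\<infinity>y\<in>?A. h' y * h' (translate G s y))"
      by (rule correlation_compactness[of p h, OF assms(2) p(1) assms(4) h(1)]) blast
    have "?D (C h') \<le> Inf ?V"
      unfolding dist_on_def[of F "C h'"]
    proof (rule cSUP_least[OF False])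
      fix s assume s: "s \<in> F"
      have "(\<lambda>n. C (h (r n)) s) \<longlonglongrightarrow> C h' s"
        unfolding C_def using lim s assms(6) by (intro tendsto_of_real) auto
      then have "(\<lambda>n. cmod (C (h (r n)) s - 1)) \<longlonglongrightarrow> cmod (C h' s - 1)"
        by (intro tendsto_intros)
      moreover have "(\<lambda>n. Inf ?V + 1 / real (Suc (r n))) \<longlonglongrightarrow> Inf ?V + 0"
        using LIMSEQ_subseq_LIMSEQ[OF LIMSEQ_Suc[OF lim_1_over_n] r]
        by (intro tendsto_add tendsto_const) (simp add: o_def)
      moreover have "cmod (C (h (r n)) s - 1) \<le> Inf ?V + 1 / real (Suc (r n))" for n
        using point[OF s, of "C (h (r n))"] h(2)[of "r n"] by linarith
      ultimately show "cmod (C h' s - 1) \<le> Inf ?V"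
        using LIMSEQ_le by fastforce
    qed
    then show ?thesis using h' cInf_lower[OF _ V(2)] by (intro bexI[of _ h']) force+
  qed
  then obtain h' where h': "h' \<in> ell_ball p ?A"
    and min: "\<And>h. h \<in> ell_ball p ?A \<Longrightarrow> ?D (C h') \<le> ?D (C h)" by blast
  have minimal: "?D (C h') \<le> ?D \<psi>" if "is_Phi_series G p g \<psi>" for g \<psi>
    using series_C[OF that] min by force
  have "is_Phi_series G p (\<lambda>i t. complex_of_real (h' (i, t))) (C h')"
    unfolding C_def by (rule Phi_series_of_ell_ball[OF assms(3) p(2) h'])
  moreover have "positive_definite G (C h')"
    unfolding C_def by (rule correlation_positive_definite[OF p h'])
  moreover have "?D (C h') \<le> ?D \<psi>" if "\<psi> \<in> P_set G p" for \<psi>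
    using Phi_series_of_P_set[OF assms(3) that] minimal by blast
  ultimately show ?thesis using minimal by blast
qed

end
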